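(* Let $\mathscr{M}=(X,\mathcal{I})$ be a finite matroid and let $k$ be an integer with $1\le k<\mathrm{rk}(\mathscr{M})$. Let $\mathrm{I}(j)$ be the number of independent sets of size $j$, and let $p(k-1)$ be the $(k-1)$-continuation number of $\mathscr{M}$. Then $$\mathrm{I}(k)^2\ \ge\ \Bigl(1+\frac1k\Bigr)\Bigl(1+\frac{1}{p(k-1)-1}\Bigr)\,\mathrm{I}(k-1)\,\mathrm{I}(k+1).$$
   Context: A matroid $\mathscr{M}=(X,\mathcal{I})$ is given by its finite ground set $X$ and its collection $\mathcal I\subseteq 2^X$ of independent sets; $\mathrm{rk}(\mathscr M)$ is the maximal size of an independent set; $\mathcal I_j=\{S\in\mathcal I: |S|=j\}$ and $\mathrm I(j)=|\mathcal I_j|$. For $S\in\mathcal I$, the set of continuations is $\mathrm{Cont}(S)=\{x\in X\setminus S: S\cup\{x\}\in\mathcal I\}$. For $x,y\in\mathrm{Cont}(S)$ write $x\sim_S y$ if $x=y$ or $S\cup\{x,y\}\notin\mathcal I$; this is an equivalence relation on $\mathrm{Cont}(S)$. Its equivalence classes are called parallel classes of $S$, and $\mathrm{Par}(S)$ is the set of parallel classes. For $0\le j<\mathrm{rk}(\mathscr M)$, the $j$-continuation number is $p(j)=\max\{|\mathrm{Par}(S)|: S\in\mathcal I_j\}$. *)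

theory Defs
  imports Complex_Main
begin

locale matroid =
  fixes X :: "'a set" and \<I> :: "'a set set"
  assumes finite_ground: "finite X"
    and indep_subset_ground: "S \<in> \<I> \<Longrightarrow> S \<subseteq> X"
    and indep_empty: "{} \<in> \<I>"
    and indep_subset: "S \<in> \<I> \<Longrightarrow> T \<subseteq> S \<Longrightarrow> T \<in> \<I>"
    and augment: "S \<in> \<I> \<Longrightarrow> T \<in> \<I> \<Longrightarrow> card T < card S \<Longrightarrow> \<exists>x \<in> S - T. insert x T \<in> \<I>"

definition matroid_rank :: "'a set set \<Rightarrow> nat" where
  "matroid_rank \<I> = Max (card ` \<I>)"

definition indep_sets :: "'a set set \<Rightarrow> nat \<Rightarrow> 'a set set" where
  "indep_sets \<I> j = {S \<in> \<I>. card S = j}"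

definition num_indep :: "'a set set \<Rightarrow> nat \<Rightarrow> nat" where
  "num_indep \<I> j = card (indep_sets \<I> j)"

definition Cont :: "'a set \<Rightarrow> 'a set set \<Rightarrow> 'a set \<Rightarrow> 'a set" where
  "Cont X \<I> S = {x \<in> X - S. S \<union> {x} \<in> \<I>}"

definition parallel_rel :: "'a set \<Rightarrow> 'a set set \<Rightarrow> 'a set \<Rightarrow> ('a \<times> 'a) set" where
  "parallel_rel X \<I> S =
     {(x, y). x \<in> Cont X \<I> S \<and> y \<in> Cont X \<I> S \<and> (x = y \<or> S \<union> {x, y} \<notin> \<I>)}"

definition Par :: "'a set \<Rightarrow> 'a set set \<Rightarrow> 'a set \<Rightarrow> 'a set set" where
  "Par X \<I> S = Cont X \<I> S // parallel_rel X \<I> S"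

definition continuation_number :: "'a set \<Rightarrow> 'a set set \<Rightarrow> nat \<Rightarrow> nat" where
  "continuation_number X \<I> j = Max ((\<lambda>S. card (Par X \<I> S)) ` indep_sets \<I> j)"

context matroid
begin

lemma finite_indep: "finite \<I>"
  using finite_ground indep_subset_ground by (meson Pow_iff finite_Pow_iff finite_subset subsetI)

lemma finite_indep_set: "S \<in> \<I> \<Longrightarrow> finite S"
  using finite_ground indep_subset_ground finite_subset by blast

lemma equiv_parallel_rel:
  assumes "S \<in> \<I>"
  shows "equiv (Cont X \<I> S) (parallel_rel X \<I> S)"
proof (rule equivI)
  show "parallel_rel X \<I> S \<subseteq> Cont X \<I> S \<times> Cont X \<I> S"
    by (auto simp: parallel_rel_def)
  show "refl_on (Cont X \<I> S) (parallel_rel X \<I> S)"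
    by (auto simp: refl_on_def parallel_rel_def)
  show "sym (parallel_rel X \<I> S)"
    by (auto simp: sym_def parallel_rel_def insert_commute)
  show "trans (parallel_rel X \<I> S)"
  proof (rule transI)
    fix x y z
    assume xy: "(x, y) \<in> parallel_rel X \<I> S" and yz: "(y, z) \<in> parallel_rel X \<I> S"
    have C: "x \<in> Cont X \<I> S" "y \<in> Cont X \<I> S" "z \<in> Cont X \<I> S"
      using xy yz by (auto simp: parallel_rel_def)
    have False if "x \<noteq> z" "S \<union> {x, z} \<in> \<I>" "x \<noteq> y" "y \<noteq> z"
    proof -
      have fS: "finite S" using assms by (rule finite_indep_set)
      have "card (S \<union> {y}) < card (S \<union> {x, z})" "S \<union> {y} \<in> \<I>"
        using C that fS by (auto simp: Cont_def)
      from augment[OF that(2) this(2,1)]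
      obtain w where "w \<in> {x, z}" "insert w (S \<union> {y}) \<in> \<I>" by auto
      then have "S \<union> {x, y} \<in> \<I> \<or> S \<union> {y, z} \<in> \<I>"
        by (auto simp: insert_commute)
      then show False using xy yz that by (auto simp: parallel_rel_def)
    qed
    then show "(x, z) \<in> parallel_rel X \<I> S"
      using C xy yz by (auto simp: parallel_rel_def)
  qed
qed

text \<open>In the range below the maximum is over a nonempty finite set and at least 2, so the
  expression \<open>1 / (p(k-1) - 1)\<close> never divides by zero.\<close>

lemma continuation_number_ge_2:
  assumes "1 \<le> k" "k < matroid_rank \<I>"
  shows "2 \<le> continuation_number X \<I> (k - 1)"
proof -
  have "matroid_rank \<I> \<in> card ` \<I>"
    unfolding matroid_rank_def using finite_indep indep_empty by (intro Max_in) auto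
  then obtain B where B: "B \<in> \<I>" "k + 1 \<le> card B" using assms by auto
  obtain T where T: "T \<subseteq> B" "card T = k + 1"
    using B obtain_subset_with_card_n by metis
  have TI: "T \<in> \<I>" using B T indep_subset by blast
  have fT: "finite T" using TI by (rule finite_indep_set)
  obtain x where x: "x \<in> T" using T by fastforce
  have "card (T - {x}) = k" using x T fT by simp
  then obtain y where y: "y \<in> T" "x \<noteq> y" using assms by (metis DiffD1 DiffD2 card.empty ex_in_conv
      insertI1 not_one_le_zero)
  define S where "S = T - {x, y}"
  have SI: "S \<in> \<I>" using TI indep_subset by (auto simp: S_def)
  have cS: "card S = k - 1" using T x y fT by (simp add: S_def card_Diff_subset)
  have "S \<union> {x} \<in> \<I>" "S \<union> {y} \<in> \<I>" "S \<union> {x, y} \<in> \<I>"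
    using x y by (auto intro!: indep_subset[OF TI] simp: S_def)
  then have C: "x \<in> Cont X \<I> S" "y \<in> Cont X \<I> S" and n: "(x, y) \<notin> parallel_rel X \<I> S"
    using x y TI indep_subset_ground by (auto simp: Cont_def S_def parallel_rel_def)
  let ?r = "parallel_rel X \<I> S"
  have "?r `` {x} \<noteq> ?r `` {y}"
    using n C equiv_parallel_rel[OF SI] by (metis eq_equiv_class)
  moreover have "{?r `` {x}, ?r `` {y}} \<subseteq> Par X \<I> S"
    using C by (auto simp: Par_def intro: quotientI)
  moreover have "finite (Par X \<I> S)"
  proof -
    have "finite (Cont X \<I> S)" using finite_ground by (simp add: Cont_def)
    then show ?thesis unfolding Par_def quotient_def by simp
  qed
  ultimately have "2 \<le> card (Par X \<I> S)"
    by (metis card_2_iff card_mono)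
  also have "\<dots> \<le> continuation_number X \<I> (k - 1)"
    unfolding continuation_number_def using SI cS finite_indep
    by (intro Max_ge) (auto simp: indep_sets_def)
  finally show ?thesis .
qed

end

end

theory Submission
  imports Defs "HOL-Analysis.Convex"
begin

text \<open>Let \<open>e\<^sub>j\<close> be the sum of the monomials \<open>w\<^sup>T\<close> over the independent sets \<open>T\<close> of size \<open>j\<close>, let
  \<open>c = 1 + 1 / (p(k-1) - 1)\<close>, and consider \<open>F = e\<^sub>k\<^sub>+\<^sub>1 + t e\<^sub>k + (c/2) t\<^sup>2 e\<^sub>k\<^sub>-\<^sub>1\<close>. The claim is the
  reverse Cauchy-Schwarz inequality for the Hessian of \<open>F\<close> at \<open>w = 1\<close>, \<open>t = 0\<close>, applied to the
  directions \<open>t\<close> and \<open>(1, \<dots>, 1)\<close>. One proves by downward induction on \<open>|S|\<close> that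
  the Hessians of all derivatives \<open>\<partial>\<^sup>S F\<close> with \<open>|S| < k\<close> satisfy this inequality. For \<open>|S| = k - 1\<close>
  the form depends on the parallel classes of \<open>S\<close>, and Cauchy-Schwarz over at most \<open>p(k-1)\<close> classes
  suffices. In the induction step Euler's identity writes the Hessian as an average of the Hessians
  of the derivatives in one more variable, and the inequalities for these combine into a
  bound of the form by the square of the matrix, which rules out a second positive
  eigenvalue.\<close>

section \<open>Solvability of finite linear systems\<close>

text \<open>Gaussian elimination, one column at a time: a zero column is dropped; otherwise a pivot
  row \<open>z\<close> clears it and the induction hypothesis applies to the reduced system.\<close>

lemma fredholm_alternative:
  fixes M :: "'b \<Rightarrow> 'a \<Rightarrow> 'f::field"
  assumes "finite X" "finite Y"
  shows "(\<exists>u. \<forall>y\<in>Y. (\<Sum>x\<in>X. M y x * u x) = b y) \<or>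
         (\<exists>n. (\<forall>x\<in>X. (\<Sum>y\<in>Y. n y * M y x) = 0) \<and> (\<Sum>y\<in>Y. n y * b y) \<noteq> 0)"
  using assms(1)
proof (induction X arbitrary: M b)
  case empty
  show ?case
  proof (cases "\<forall>y\<in>Y. b y = 0")
    case False
    then obtain z where "z \<in> Y" "b z \<noteq> 0" by blast
    then have "(\<Sum>y\<in>Y. (if y = z then 1 else 0) * b y) \<noteq> 0"
      using assms(2) by (simp add: if_distrib[of "\<lambda>t. t * _"] cong: if_cong)
    then show ?thesis by (intro disjI2 exI[of _ "\<lambda>y. if y = z then 1 else 0"]) simp
  qed simp
next
  case (insert a X)
  show ?case
  proof (cases "\<forall>y\<in>Y. M y a = 0")
    case True
    then have "(\<Sum>y\<in>Y. n y * M y a) = 0" for n by simp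
    then show ?thesis using insert.IH[of M b] insert.hyps True by simp
  next
    case False
    then obtain z where z: "z \<in> Y" "M z a \<noteq> 0" by blast
    define f where "f y = M y a / M z a" for y
    have fa: "f y * M z a = M y a" for y using z by (simp add: f_def)
    \<comment> \<open>Row \<open>z\<close> itself reduces to 0 because \<open>f z = 1\<close>, so it
      can stay in \<open>Y\<close> without imposing a condition.\<close>
    define M' where "M' y x = M y x - f y * M z x" for y x
    define b' where "b' y = b y - f y * b z" for y
    consider u where "\<forall>y\<in>Y. (\<Sum>x\<in>X. M' y x * u x) = b' y"
      | n where "\<forall>x\<in>X. (\<Sum>y\<in>Y. n y * M' y x) = 0" "(\<Sum>y\<in>Y. n y * b' y) \<noteq> 0"
      using insert.IH[of M' b'] by blast
    then show ?thesis
    proof cases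
      case 1
      define s where "s = (b z - (\<Sum>x\<in>X. M z x * u x)) / M z a"
      have "(\<Sum>x\<in>insert a X. M y x * (u(a := s)) x) = b y" if "y \<in> Y" for y
      proof -
        have "(\<Sum>x\<in>insert a X. M y x * (u(a := s)) x) = M y a * s + (\<Sum>x\<in>X. M y x * u x)"
          using insert.hyps by (auto intro!: sum.cong)
        also have "M y a * s = f y * (b z - (\<Sum>x\<in>X. M z x * u x))"
          using z by (simp add: s_def f_def)
        also have "\<dots> + (\<Sum>x\<in>X. M y x * u x) = f y * b z + (\<Sum>x\<in>X. M' y x * u x)"
          by (simp add: M'_def algebra_simps sum_subtractf sum_distrib_left)
        finally show ?thesis using 1 that by (simp add: b'_def)
      qed
      then show ?thesis by blast
    next
      case 2
      \<comment> \<open>Correcting \<open>n\<close> at the pivot row turns a certificate of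
        unsolvability for the reduced system into one for the original system.\<close>
      define t where "t = (\<Sum>y\<in>Y. n y * f y)"
      define n' where "n' y = n y - (if y = z then t else 0)" for y
      have *: "(\<Sum>y\<in>Y. n' y * g y) = (\<Sum>y\<in>Y. n y * (g y - f y * g z))" for g
      proof -
        have "(\<Sum>y\<in>Y. n' y * g y) = (\<Sum>y\<in>Y. n y * g y) - (\<Sum>y\<in>Y. (if y = z then t * g z else 0))"
          by (auto simp: n'_def left_diff_distrib sum_subtractf intro!: sum.cong)
        also have "\<dots> = (\<Sum>y\<in>Y. n y * g y) - t * g z" using z assms(2) by simp
        finally show ?thesis
          by (simp add: t_def right_diff_distrib sum_subtractf sum_distrib_right mult.assoc)
      qed
      have "(\<Sum>y\<in>Y. n' y * M y x) = 0" if "x \<in> insert a X" for x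
        using that 2(1) by (auto simp: * fa M'_def)
      moreover have "(\<Sum>y\<in>Y. n' y * b y) \<noteq> 0"
        using 2(2) by (simp add: * b'_def)
      ultimately show ?thesis by blast
    qed
  qed
qed

section \<open>Bilinear forms and hyperbolicity\<close>

definition bilin :: "'a set \<Rightarrow> ('a \<Rightarrow> 'a \<Rightarrow> real) \<Rightarrow> ('a \<Rightarrow> real) \<Rightarrow> ('a \<Rightarrow> real) \<Rightarrow> real" where
  "bilin X P u v = (\<Sum>x\<in>X. u x * (\<Sum>y\<in>X. P x y * v y))"

lemma bilin_add_left: "bilin X P (\<lambda>x. u x + w x) v = bilin X P u v + bilin X P w v"
  by (simp add: bilin_def distrib_right sum.distrib)

lemma bilin_scale_left: "bilin X P (\<lambda>x. s * u x) v = s * bilin X P u v"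
  by (simp add: bilin_def sum_distrib_left mult_ac)

lemma bilin_commute:
  assumes "\<And>x y. x \<in> X \<Longrightarrow> y \<in> X \<Longrightarrow> P x y = P y x"
  shows "bilin X P u v = bilin X P v u"
proof -
  have "bilin X P u v = (\<Sum>x\<in>X. \<Sum>y\<in>X. u x * (P x y * v y))"
    by (simp add: bilin_def sum_distrib_left)
  also have "\<dots> = (\<Sum>y\<in>X. \<Sum>x\<in>X. u x * (P x y * v y))" by (rule sum.swap)
  also have "\<dots> = bilin X P v u"
    using assms by (auto simp: bilin_def sum_distrib_left mult_ac intro!: sum.cong)
  finally show ?thesis .
qed

lemma bilin_add_square:
  assumes "\<And>x y. x \<in> X \<Longrightarrow> y \<in> X \<Longrightarrow> P x y = P y x"
  shows "bilin X P (\<lambda>x. u x + s * v x) (\<lambda>x. u x + s * v x) =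
    bilin X P u u + 2 * s * bilin X P u v + s\<^sup>2 * bilin X P v v"
proof -
  have *: "bilin X P w (\<lambda>x. u x + s * v x) = bilin X P u w + s * bilin X P v w" for w
    using bilin_commute[of X P, OF assms, of w] by (simp add: bilin_add_left bilin_scale_left)
  show ?thesis
    unfolding bilin_add_left bilin_scale_left *
    using bilin_commute[of X P, OF assms, of v u] by (simp add: power2_eq_square algebra_simps)
qed

lemma bilin_Cauchy_Schwarz:
  assumes "\<And>x y. x \<in> X \<Longrightarrow> y \<in> X \<Longrightarrow> P x y = P y x" and psd: "\<And>u. 0 \<le> bilin X P u u"
  shows "(bilin X P u v)\<^sup>2 \<le> bilin X P u u * bilin X P v v"
proof -
  let ?a = "bilin X P u u" and ?b = "bilin X P u v" and ?c = "bilin X P v v"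
  have *: "0 \<le> ?a + 2 * s * ?b + s\<^sup>2 * ?c" for s
    using psd[of "\<lambda>x. u x + s * v x"] bilin_add_square[of X P, OF assms(1), of u s v] by simp
  show ?thesis
  proof (cases "?c = 0")
    case True
    \<comment> \<open>Here the quadratic in \<open>s\<close> is affine; a nonzero slope would let it
      take the value -1.\<close>
    have "?b = 0"
    proof (rule ccontr)
      assume "?b \<noteq> 0"
      then have "2 * (- (?a + 1) / (2 * ?b)) * ?b = - (?a + 1)" by simp
      then show False using *[of "- (?a + 1) / (2 * ?b)"] True by simp
    qed
    then show ?thesis using True by simp
  next
    case False
    then have c: "?c > 0" using psd[of v] by simp
    then have "0 \<le> (?a + 2 * (- ?b / ?c) * ?b + (- ?b / ?c)\<^sup>2 * ?c) * ?c"
      using *[of "- ?b / ?c"] by (intro mult_nonneg_nonneg) auto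
    also have "\<dots> = ?a * ?c - ?b\<^sup>2" using c by (simp add: field_simps power2_eq_square)
    finally show ?thesis by simp
  qed
qed

text \<open>The quadratic form of the symmetric matrix with block \<open>P\<close>, border \<open>q\<close> and corner \<open>r\<close>;
  hyperbolicity is the reverse Cauchy-Schwarz inequality against the vector that is 1 on \<open>X\<close>
  and 0 in the corner coordinate.\<close>

definition bordered :: "'a set \<Rightarrow> ('a \<Rightarrow> 'a \<Rightarrow> real) \<Rightarrow> ('a \<Rightarrow> real) \<Rightarrow> real \<Rightarrow> ('a \<Rightarrow> real) \<Rightarrow> real \<Rightarrow> real" where
  "bordered X P q r u t = bilin X P u u + 2 * t * (\<Sum>x\<in>X. q x * u x) + r * t\<^sup>2"

definition hyperbolic :: "'a set \<Rightarrow> ('a \<Rightarrow> 'a \<Rightarrow> real) \<Rightarrow> ('a \<Rightarrow> real) \<Rightarrow> real \<Rightarrow> bool" where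
  "hyperbolic X P q r \<longleftrightarrow> (\<forall>u t. bordered X P q r u t * (\<Sum>x\<in>X. \<Sum>y\<in>X. P x y) \<le>
     ((\<Sum>x\<in>X. (\<Sum>y\<in>X. P x y) * u x) + t * (\<Sum>x\<in>X. q x))\<^sup>2)"

lemma bordered_shift:
  assumes "\<And>x y. x \<in> X \<Longrightarrow> y \<in> X \<Longrightarrow> P x y = P y x"
  shows "bordered X P q r (\<lambda>x. u x + s) t = bordered X P q r u t +
     2 * s * ((\<Sum>x\<in>X. (\<Sum>y\<in>X. P x y) * u x) + t * (\<Sum>x\<in>X. q x)) + s\<^sup>2 * (\<Sum>x\<in>X. \<Sum>y\<in>X. P x y)"
proof -
  have "bilin X P u (\<lambda>_. 1) = (\<Sum>x\<in>X. (\<Sum>y\<in>X. P x y) * u x)" "bilin X P (\<lambda>_. 1) (\<lambda>_. 1) = (\<Sum>x\<in>X. \<Sum>y\<in>X. P x y)"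
    by (simp_all add: bilin_def mult.commute)
  then show ?thesis
    using bilin_add_square[of X P, OF assms, of u s "\<lambda>_. 1"]
    by (simp add: bordered_def algebra_simps sum.distrib sum_distrib_left)
qed

text \<open>Completing the square along the line \<open>u + s\<close>: with \<open>W\<close> the
  total sum and \<open>L\<close> the linear form, the value at \<open>u\<close> times
  \<open>W\<close> is the value at \<open>u + s\<close> times \<open>W\<close>, plus
  \<open>L\<^sup>2 - (L + s W)\<^sup>2\<close>. One nonpositive value on the line thus
  suffices.\<close>

lemma hyperbolic_if_shift:
  assumes "\<And>x y. x \<in> X \<Longrightarrow> y \<in> X \<Longrightarrow> P x y = P y x"
    and W: "0 \<le> (\<Sum>x\<in>X. \<Sum>y\<in>X. P x y)"
    and sh: "\<And>u t. (\<Sum>x\<in>X. \<Sum>y\<in>X. P x y) \<noteq> 0 \<Longrightarrow> \<exists>s. bordered X P q r (\<lambda>x. u x + s) t \<le> 0"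
  shows "hyperbolic X P q r"
  unfolding hyperbolic_def
proof (intro allI)
  fix u t
  let ?W = "\<Sum>x\<in>X. \<Sum>y\<in>X. P x y" and ?Q = "bordered X P q r u t"
  let ?L = "(\<Sum>x\<in>X. (\<Sum>y\<in>X. P x y) * u x) + t * (\<Sum>x\<in>X. q x)"
  show "?Q * ?W \<le> ?L\<^sup>2"
  proof (cases "?W = 0")
    case True
    show ?thesis unfolding True by simp
  next
    case False
    from sh[OF this, of u t] obtain s where "?Q + 2 * s * ?L + s\<^sup>2 * ?W \<le> 0"
      using bordered_shift[of X P, OF assms(1)] by auto
    then have "(?Q + 2 * s * ?L + s\<^sup>2 * ?W) * ?W \<le> 0"
      using W by (rule mult_nonpos_nonneg)
    moreover have "?Q * ?W = (?Q + 2 * s * ?L + s\<^sup>2 * ?W) * ?W + ?L\<^sup>2 - (?L + s * ?W)\<^sup>2"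
      by (simp only: power2_eq_square) algebra
    ultimately show ?thesis using zero_le_power2[of "?L + s * ?W"] by linarith
  qed
qed

section \<open>Hyperbolicity from a bound by the squared matrix\<close>

text \<open>For nonnegative weights this shows that the Laplacian is positive semidefinite and that
  its null vectors are constant along edges.\<close>

lemma dirichlet_form:
  assumes "\<And>x y. x \<in> X \<Longrightarrow> y \<in> X \<Longrightarrow> P x y = P y x"
  shows "(\<Sum>x\<in>X. \<Sum>y\<in>X. P x y * (u x - u y)\<^sup>2) =
    2 * ((\<Sum>x\<in>X. (\<Sum>y\<in>X. P x y) * (u x)\<^sup>2) - bilin X P u u)"
proof -
  have "(\<Sum>x\<in>X. \<Sum>y\<in>X. P x y * (u y)\<^sup>2) = (\<Sum>y\<in>X. \<Sum>x\<in>X. P x y * (u y)\<^sup>2)" by (rule sum.swap)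
  also have "\<dots> = (\<Sum>x\<in>X. (\<Sum>y\<in>X. P x y) * (u x)\<^sup>2)"
    using assms by (auto simp: sum_distrib_right intro!: sum.cong)
  finally have 1: "(\<Sum>x\<in>X. \<Sum>y\<in>X. P x y * (u y)\<^sup>2) = (\<Sum>x\<in>X. (\<Sum>y\<in>X. P x y) * (u x)\<^sup>2)" .
  have "(\<Sum>x\<in>X. \<Sum>y\<in>X. P x y * (u x - u y)\<^sup>2) = (\<Sum>x\<in>X. \<Sum>y\<in>X. P x y * (u x)\<^sup>2)
     + (\<Sum>x\<in>X. \<Sum>y\<in>X. P x y * (u y)\<^sup>2) - 2 * bilin X P u u"
    by (simp add: bilin_def power2_eq_square algebra_simps sum.distrib sum_subtractf sum_distrib_left)
  then show ?thesis unfolding 1 by (simp add: sum_distrib_right)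
qed

text \<open>With \<open>D\<close> the diagonal of row sums, the hypothesis reads \<open>P \<le> P D\<^sup>-\<^sup>1 P\<close>, so the eigenvalues
  of \<open>D\<^sup>-\<^sup>1 P\<close> are nonpositive or at least 1, while connectedness makes 1 a simple top eigenvalue.
  The proof replaces spectral theory by solving \<open>(D - P) v = D u\<close> and applying Cauchy-Schwarz to
  the Laplacian \<open>D - P\<close>. Rows with zero sum are allowed: there \<open>/\<close> yields 0.\<close>

lemma nonpos_on_orthogonal_complement:
  fixes P :: "'a \<Rightarrow> 'a \<Rightarrow> real"
  defines "D \<equiv> \<lambda>x X. \<Sum>y\<in>X. P x y"
  assumes fin: "finite X" and sym: "\<And>x y. x \<in> X \<Longrightarrow> y \<in> X \<Longrightarrow> P x y = P y x"
    and nonneg: "\<And>x y. x \<in> X \<Longrightarrow> y \<in> X \<Longrightarrow> 0 \<le> P x y"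
    and conn: "\<And>(f :: 'a \<Rightarrow> real) x y. (\<And>a b. a \<in> X \<Longrightarrow> b \<in> X \<Longrightarrow> P a b \<noteq> 0 \<Longrightarrow> f a = f b) \<Longrightarrow>
        x \<in> X \<Longrightarrow> y \<in> X \<Longrightarrow> D x X \<noteq> 0 \<Longrightarrow> D y X \<noteq> 0 \<Longrightarrow> f x = f y"
    and ineq: "\<And>v. bilin X P v v \<le> (\<Sum>x\<in>X. (\<Sum>y\<in>X. P x y * v y)\<^sup>2 / D x X)"
    and orth: "(\<Sum>x\<in>X. D x X * u x) = 0"
  shows "bilin X P u u \<le> 0"
proof -
  let ?D = "\<lambda>x. D x X"
  define N where "N x y = (if x = y then ?D x else 0) - P x y" for x y
  have Dpos: "0 \<le> ?D x" if "x \<in> X" for x using nonneg that by (simp add: D_def sum_nonneg)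
  have PD: "P x y = 0" if "?D x = 0" "x \<in> X" "y \<in> X" for x y
    using that nonneg fin sum_nonneg_eq_0_iff[of X "P x"] by (simp add: D_def)
  have Nsym: "N x y = N y x" if "x \<in> X" "y \<in> X" for x y using that sym by (auto simp: N_def)
  have Nv: "(\<Sum>y\<in>X. N x y * v y) = ?D x * v x - (\<Sum>y\<in>X. P x y * v y)" if "x \<in> X" for x v
    using that fin by (simp add: N_def left_diff_distrib sum_subtractf if_distrib[of "\<lambda>t. t * _"] cong: if_cong)
  have NB: "bilin X N v w = (\<Sum>x\<in>X. ?D x * (v x * w x)) - bilin X P v w" for v w
  proof -
    have "bilin X N v w = (\<Sum>x\<in>X. v x * (?D x * w x - (\<Sum>y\<in>X. P x y * w y)))"
      unfolding bilin_def using Nv by (intro sum.cong) auto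
    then show ?thesis by (simp add: bilin_def right_diff_distrib sum_subtractf mult.left_commute)
  qed
  have NBB: "2 * bilin X N v v = (\<Sum>x\<in>X. \<Sum>y\<in>X. P x y * (v x - v y)\<^sup>2)" for v
    unfolding dirichlet_form[of X P, OF sym, simplified] NB by (simp add: D_def power2_eq_square)
  have psd: "0 \<le> bilin X N v v" for v
  proof -
    have "0 \<le> (\<Sum>x\<in>X. \<Sum>y\<in>X. P x y * (v x - v y)\<^sup>2)"
      using nonneg by (intro sum_nonneg mult_nonneg_nonneg) auto
    then show ?thesis using NBB[of v] by simp
  qed
  \<comment> \<open>The obstruction to solving \<open>N v = D u\<close> would be a null vector of
    the Laplacian. By connectedness it is constant wherever the row sum is nonzero, so
    \<open>orth\<close> makes it harmless.\<close>
  have "\<not> (\<exists>n. (\<forall>x\<in>X. (\<Sum>y\<in>X. n y * N y x) = 0) \<and> (\<Sum>y\<in>X. n y * (?D y * u y)) \<noteq> 0)"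
  proof
    assume "\<exists>n. (\<forall>x\<in>X. (\<Sum>y\<in>X. n y * N y x) = 0) \<and> (\<Sum>y\<in>X. n y * (?D y * u y)) \<noteq> 0"
    then obtain n where n: "\<And>x. x \<in> X \<Longrightarrow> (\<Sum>y\<in>X. n y * N y x) = 0" "(\<Sum>y\<in>X. n y * (?D y * u y)) \<noteq> 0"
      by blast
    have "(\<Sum>y\<in>X. N x y * n y) = 0" if "x \<in> X" for x
      using n(1)[OF that] Nsym that by (simp add: mult.commute cong: sum.cong)
    then have "bilin X N n n = 0" by (simp add: bilin_def)
    then have "(\<Sum>x\<in>X. \<Sum>y\<in>X. P x y * (n x - n y)\<^sup>2) = 0" using NBB[of n] by simp
    then have "\<forall>x\<in>X. \<forall>y\<in>X. P x y * (n x - n y)\<^sup>2 = 0"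
      using fin nonneg by (simp add: sum_nonneg_eq_0_iff sum_nonneg)
    then have c: "n x = n y" if "x \<in> X" "y \<in> X" "?D x \<noteq> 0" "?D y \<noteq> 0" for x y
      using conn[of n x y] that by auto
    have "\<exists>z\<in>X. ?D z \<noteq> 0"
    proof (rule ccontr)
      assume "\<not> (\<exists>z\<in>X. ?D z \<noteq> 0)"
      then have "(\<Sum>y\<in>X. n y * (?D y * u y)) = 0" by (intro sum.neutral) auto
      then show False using n(2) by simp
    qed
    then obtain z where z: "z \<in> X" "?D z \<noteq> 0" by blast
    have "(\<Sum>y\<in>X. n y * (?D y * u y)) = (\<Sum>y\<in>X. n z * (?D y * u y))"
    proof (rule sum.cong)
      fix y assume "y \<in> X"
      then show "n y * (?D y * u y) = n z * (?D y * u y)" using c[of y z] z by (cases "?D y = 0") auto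
    qed simp
    also have "\<dots> = 0" using orth by (simp flip: sum_distrib_left)
    finally show False using n(2) by simp
  qed
  then obtain v where v: "\<And>x. x \<in> X \<Longrightarrow> (\<Sum>y\<in>X. N x y * v y) = ?D x * u x"
    using fredholm_alternative[OF fin fin, of N "\<lambda>x. ?D x * u x"] by blast
  let ?a = "\<Sum>x\<in>X. ?D x * (u x * u x)" and ?b = "\<Sum>x\<in>X. ?D x * (v x * u x)"
  have uv: "bilin X N u v = ?a" by (simp add: bilin_def v mult.left_commute cong: sum.cong)
  have vv: "bilin X N v v = ?b" by (simp add: bilin_def v mult.left_commute cong: sum.cong)
  \<comment> \<open>Since \<open>P v = D (v - u)\<close>, the hypothesis at \<open>v\<close>
    compares \<open>D v v - ?b\<close> with \<open>D v v - 2 ?b + ?a\<close>.\<close>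
  have "?b \<le> ?a"
  proof -
    have "(\<Sum>x\<in>X. (\<Sum>y\<in>X. P x y * v y)\<^sup>2 / ?D x) = (\<Sum>x\<in>X. ?D x * (v x - u x)\<^sup>2)"
    proof (rule sum.cong)
      fix x assume x: "x \<in> X"
      have "(\<Sum>y\<in>X. P x y * v y) = ?D x * (v x - u x)"
        using Nv[OF x, of v] v[OF x] by (simp add: algebra_simps)
      then show "(\<Sum>y\<in>X. P x y * v y)\<^sup>2 / ?D x = ?D x * (v x - u x)\<^sup>2"
        by (simp add: power2_eq_square)
    qed simp
    also have "\<dots> = (\<Sum>x\<in>X. ?D x * (v x * v x)) - 2 * ?b + ?a"
      by (simp add: power2_eq_square algebra_simps sum.distrib sum_subtractf sum_distrib_left)
    finally show ?thesis using ineq[of v] vv by (simp add: NB)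
  qed
  have a: "0 \<le> ?a" using Dpos by (intro sum_nonneg) simp
  \<comment> \<open>Cancelling a positive \<open>?a\<close> from the resulting chain leaves
    \<open>?a \<le> bilin X N u u\<close>, whose right side is
    \<open>?a - bilin X P u u\<close>.\<close>
  have "?a\<^sup>2 \<le> bilin X N u u * ?b"
    using bilin_Cauchy_Schwarz[of X N, OF Nsym psd, of u v] uv vv by simp
  also have "\<dots> \<le> bilin X N u u * ?a" using \<open>?b \<le> ?a\<close> psd[of u] by (rule mult_left_mono)
  finally have le: "?a * ?a \<le> bilin X N u u * ?a" by (simp add: power2_eq_square)
  show ?thesis
  proof (cases "?a = 0")
    case True
    then have "\<forall>x\<in>X. ?D x * (u x * u x) = 0" using fin Dpos by (subst (asm) sum_nonneg_eq_0_iff) auto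
    then have "u x * (\<Sum>y\<in>X. P x y * u y) = 0" if "x \<in> X" for x using that PD by force
    then have "bilin X P u u = 0" unfolding bilin_def by (intro sum.neutral) blast
    then show ?thesis by simp
  next
    case False
    then have "?a \<le> bilin X N u u" using le a by simp
    then show ?thesis by (simp add: NB)
  qed
qed

text \<open>The hypothesis with \<open>t = 0\<close> makes the block nonpositive on vectors
  orthogonal to the row sums. The border is removed by solving \<open>P w = - q\<close>, and
  subtracting a constant achieves orthogonality.\<close>

lemma hyperbolic_step:
  fixes P :: "'a \<Rightarrow> 'a \<Rightarrow> real"
  assumes fin: "finite X" and sym: "\<And>x y. x \<in> X \<Longrightarrow> y \<in> X \<Longrightarrow> P x y = P y x"
    and nonneg: "\<And>x y. x \<in> X \<Longrightarrow> y \<in> X \<Longrightarrow> 0 \<le> P x y"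
    and conn: "\<And>(f :: 'a \<Rightarrow> real) x y. (\<And>a b. a \<in> X \<Longrightarrow> b \<in> X \<Longrightarrow> P a b \<noteq> 0 \<Longrightarrow> f a = f b) \<Longrightarrow>
        x \<in> X \<Longrightarrow> y \<in> X \<Longrightarrow> (\<Sum>z\<in>X. P x z) \<noteq> 0 \<Longrightarrow> (\<Sum>z\<in>X. P y z) \<noteq> 0 \<Longrightarrow> f x = f y"
    and ineq: "\<And>u t. bordered X P q r u t \<le>
        (\<Sum>x\<in>X. ((\<Sum>y\<in>X. P x y * u y) + t * q x)\<^sup>2 / (\<Sum>y\<in>X. P x y))"
  shows "hyperbolic X P q r"
proof (rule hyperbolic_if_shift[OF sym])
  let ?D = "\<lambda>x. \<Sum>y\<in>X. P x y"
  show "0 \<le> (\<Sum>x\<in>X. ?D x)" using nonneg by (intro sum_nonneg)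
  have np: "bilin X P z z \<le> 0" if "(\<Sum>x\<in>X. ?D x * z x) = 0" for z
    using fin sym nonneg conn _ that
  proof (rule nonpos_on_orthogonal_complement)
    show "bilin X P v v \<le> (\<Sum>x\<in>X. (\<Sum>y\<in>X. P x y * v y)\<^sup>2 / ?D x)" for v
      using ineq[of v 0] by (simp add: bordered_def)
  qed
  fix u t assume W: "(\<Sum>x\<in>X. ?D x) \<noteq> 0"
  \<comment> \<open>A null vector \<open>n\<close> of \<open>P\<close> with nonzero pairing against
    \<open>q\<close> would make the left side of \<open>ineq\<close> at \<open>(s n, 1)\<close>
    unbounded in \<open>s\<close>, while the right side stays constant.\<close>
  have "\<not> (\<exists>n. (\<forall>x\<in>X. (\<Sum>y\<in>X. n y * P y x) = 0) \<and> (\<Sum>y\<in>X. n y * - q y) \<noteq> 0)"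
  proof
    assume "\<exists>n. (\<forall>x\<in>X. (\<Sum>y\<in>X. n y * P y x) = 0) \<and> (\<Sum>y\<in>X. n y * - q y) \<noteq> 0"
    then obtain n where n: "\<And>x. x \<in> X \<Longrightarrow> (\<Sum>y\<in>X. n y * P y x) = 0" "(\<Sum>y\<in>X. n y * - q y) \<noteq> 0"
      by blast
    have Pn: "(\<Sum>y\<in>X. P x y * n y) = 0" if "x \<in> X" for x
      using n(1)[OF that] sym that by (simp add: mult.commute cong: sum.cong)
    let ?c = "\<Sum>x\<in>X. q x * n x" and ?K = "\<Sum>x\<in>X. (q x)\<^sup>2 / ?D x"
    have c: "?c \<noteq> 0" using n(2) by (simp add: mult.commute sum_negf)
    have le: "2 * (s * ?c) + r \<le> ?K" for s
    proof -
      have "(\<Sum>y\<in>X. P x y * (s * n y)) = 0" if "x \<in> X" for x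
        using Pn[OF that] by (simp add: mult.left_commute flip: sum_distrib_left)
      moreover have "(\<Sum>x\<in>X. q x * (s * n x)) = s * ?c" by (simp add: sum_distrib_left mult_ac)
      ultimately show ?thesis using ineq[of "\<lambda>x. s * n x" 1] by (simp add: bordered_def bilin_def)
    qed
    have "2 * ((?K - r + 1) / (2 * ?c) * ?c) = ?K - r + 1" using c by simp
    then show False using le[of "(?K - r + 1) / (2 * ?c)"] by linarith
  qed
  then obtain w where w: "\<And>x. x \<in> X \<Longrightarrow> (\<Sum>y\<in>X. P x y * w y) = - q x"
    using fredholm_alternative[OF fin fin, of P "\<lambda>x. - q x"] by blast
  \<comment> \<open>Every row \<open>P w + q\<close> vanishes, so the right side of
    \<open>ineq\<close> is 0.\<close>
  have Qw: "bordered X P q r w 1 \<le> 0" using ineq[of w 1] w by simp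
  have bw: "bilin X P z w = - (\<Sum>x\<in>X. q x * z x)" for z
  proof -
    have "bilin X P z w = (\<Sum>x\<in>X. z x * - q x)"
      unfolding bilin_def using w by (intro sum.cong) auto
    then show ?thesis by (simp add: sum_negf mult.commute)
  qed
  text \<open>The vector \<open>(w, 1)\<close> is orthogonal to all vectors supported on \<open>X\<close> and the form is
    nonpositive on it, so only the component supported on \<open>X\<close> matters.\<close>
  define s where "s = - (\<Sum>x\<in>X. ?D x * (u x - t * w x)) / (\<Sum>x\<in>X. ?D x)"
  define z where "z x = u x - t * w x + s" for x
  have "(\<Sum>x\<in>X. ?D x * z x) = (\<Sum>x\<in>X. ?D x * (u x - t * w x)) + s * (\<Sum>x\<in>X. ?D x)"
    by (simp add: z_def distrib_left sum.distrib mult.commute[of s] sum_distrib_right)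
  also have "\<dots> = 0" using W by (simp add: s_def)
  finally have zz: "bilin X P z z \<le> 0" by (rule np)
  have us: "(\<lambda>x. u x + s) = (\<lambda>x. z x + t * w x)" by (simp add: z_def fun_eq_iff)
  have "bordered X P q r (\<lambda>x. u x + s) t = bilin X P z z + t\<^sup>2 * bordered X P q r w 1"
  proof -
    have "bilin X P (\<lambda>x. z x + t * w x) (\<lambda>x. z x + t * w x) =
        bilin X P z z + 2 * t * bilin X P z w + t\<^sup>2 * bilin X P w w"
      by (rule bilin_add_square[OF sym])
    moreover have "(\<Sum>x\<in>X. q x * (z x + t * w x)) = (\<Sum>x\<in>X. q x * z x) + t * (\<Sum>x\<in>X. q x * w x)"
      by (simp add: distrib_left sum.distrib sum_distrib_left mult.left_commute)
    ultimately show ?thesis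
      unfolding us bordered_def bw by (simp add: power2_eq_square algebra_simps)
  qed
  also have "\<dots> \<le> 0" using zz Qw by (simp add: add_nonpos_nonpos mult_nonneg_nonpos)
  finally show "\<exists>s. bordered X P q r (\<lambda>x. u x + s) t \<le> 0" by blast
qed

text \<open>The form is linear in its matrix, so Euler's identity for the entries passes to the
  form.\<close>

lemma bordered_sum:
  assumes P: "\<And>x y. x \<in> X \<Longrightarrow> y \<in> X \<Longrightarrow> m * P x y = (\<Sum>z\<in>Z. P' z x y)"
    and q: "\<And>x. x \<in> X \<Longrightarrow> m * q x = (\<Sum>z\<in>Z. q' z x)" and r: "m * r = (\<Sum>z\<in>Z. r' z)"
  shows "m * bordered X P q r u t = (\<Sum>z\<in>Z. bordered X (P' z) (q' z) (r' z) u t)"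
proof -
  have "m * bilin X P u u = (\<Sum>x\<in>X. \<Sum>y\<in>X. (m * P x y) * (u x * u y))"
    by (simp add: bilin_def sum_distrib_left mult_ac)
  also have "\<dots> = (\<Sum>x\<in>X. \<Sum>y\<in>X. \<Sum>z\<in>Z. P' z x y * (u x * u y))"
    by (intro sum.cong refl) (simp add: P sum_distrib_right)
  also have "\<dots> = (\<Sum>x\<in>X. \<Sum>z\<in>Z. \<Sum>y\<in>X. P' z x y * (u x * u y))"
    by (intro sum.cong refl sum.swap)
  also have "\<dots> = (\<Sum>z\<in>Z. \<Sum>x\<in>X. \<Sum>y\<in>X. P' z x y * (u x * u y))" by (rule sum.swap)
  also have "\<dots> = (\<Sum>z\<in>Z. bilin X (P' z) u u)"
    by (simp add: bilin_def sum_distrib_left mult_ac)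
  finally have 1: "m * bilin X P u u = (\<Sum>z\<in>Z. bilin X (P' z) u u)" .
  have "m * (\<Sum>x\<in>X. q x * u x) = (\<Sum>x\<in>X. (m * q x) * u x)"
    by (simp add: sum_distrib_left mult.assoc)
  also have "\<dots> = (\<Sum>x\<in>X. \<Sum>z\<in>Z. q' z x * u x)"
    by (intro sum.cong refl) (simp add: q sum_distrib_right)
  also have "\<dots> = (\<Sum>z\<in>Z. \<Sum>x\<in>X. q' z x * u x)" by (rule sum.swap)
  finally have 2: "m * (\<Sum>x\<in>X. q x * u x) = (\<Sum>z\<in>Z. \<Sum>x\<in>X. q' z x * u x)" .
  have "m * bordered X P q r u t =
      m * bilin X P u u + 2 * t * (m * (\<Sum>x\<in>X. q x * u x)) + (m * r) * t\<^sup>2"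
    by (simp add: bordered_def algebra_simps)
  then show ?thesis
    unfolding 1 2 r by (simp add: bordered_def sum.distrib sum_distrib_left sum_distrib_right)
qed

section \<open>Counting independent extensions\<close>

text \<open>The derivative of \<open>e\<^sub>j\<close> along \<open>T\<close>, evaluated at
  \<open>w = 1\<close>.\<close>

definition num_ext :: "'a set set \<Rightarrow> nat \<Rightarrow> 'a set \<Rightarrow> real" where
  "num_ext \<I> j T = real (card {S \<in> \<I>. card S = j \<and> T \<subseteq> S})"

text \<open>For independent \<open>S\<close>, the matrix with block \<open>ext_matrix\<close>, border \<open>ext_vector\<close> and corner
  \<open>c * num_ext \<I> (k - 1) S\<close> is the Hessian, at \<open>w = 1\<close> and \<open>t = 0\<close>, of the derivative along \<open>S\<close> of the
  polynomial \<open>F\<close> above.\<close>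

definition ext_matrix :: "'a set set \<Rightarrow> nat \<Rightarrow> 'a set \<Rightarrow> 'a \<Rightarrow> 'a \<Rightarrow> real" where
  "ext_matrix \<I> k S x y =
     (if x \<noteq> y \<and> x \<notin> S \<and> y \<notin> S then num_ext \<I> (k + 1) (insert x (insert y S)) else 0)"

definition ext_vector :: "'a set set \<Rightarrow> nat \<Rightarrow> 'a set \<Rightarrow> 'a \<Rightarrow> real" where
  "ext_vector \<I> k S x = (if x \<notin> S then num_ext \<I> k (insert x S) else 0)"

lemma num_ext_nonneg: "0 \<le> num_ext \<I> j T"
  by (simp add: num_ext_def)

lemma num_ext_empty: "num_ext \<I> j {} = real (num_indep \<I> j)"
  by (simp add: num_ext_def num_indep_def indep_sets_def)

lemma ext_matrix_commute: "ext_matrix \<I> k S x y = ext_matrix \<I> k S y x"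
  by (auto simp: ext_matrix_def insert_commute)

lemma ext_matrix_nonneg: "0 \<le> ext_matrix \<I> k S x y"
  by (simp add: ext_matrix_def num_ext_nonneg)

context matroid
begin

lemma num_ext_dependent: "T \<notin> \<I> \<Longrightarrow> num_ext \<I> j T = 0"
  using indep_subset by (auto simp: num_ext_def card_eq_0_iff)

lemma num_ext_card:
  assumes "finite T"
  shows "num_ext \<I> (card T) T = of_bool (T \<in> \<I>)"
proof (cases "T \<in> \<I>")
  case True
  have "S = T" if "S \<in> \<I>" "card S = card T" "T \<subseteq> S" for S
    using card_subset_eq[of S T] finite_indep_set that by auto
  then have "{S \<in> \<I>. card S = card T \<and> T \<subseteq> S} = {T}" using True by auto
  then show ?thesis using True by (simp add: num_ext_def)
qed (simp add: num_ext_dependent)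

text \<open>Euler's identity in degree \<open>j - card T\<close>, by counting pairs of a set
  \<open>S\<close> and an element of \<open>S - T\<close>. The factor is a difference of reals; if
  \<open>card T > j\<close>, no set is counted and both sides are 0.\<close>

lemma sum_num_ext_insert:
  "(\<Sum>z\<in>X - T. num_ext \<I> j (insert z T)) = (real j - real (card T)) * num_ext \<I> j T"
proof -
  let ?F = "{S \<in> \<I>. card S = j \<and> T \<subseteq> S}"
  have fin: "finite ?F" using finite_indep by simp
  have "num_ext \<I> j (insert z T) = (\<Sum>S\<in>?F. of_bool (z \<in> S))" for z
  proof -
    have "{S \<in> \<I>. card S = j \<and> insert z T \<subseteq> S} = ?F \<inter> {S. z \<in> S}" by auto
    then show ?thesis using fin by (simp add: num_ext_def sum.If_cases of_bool_def)
  qed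
  then have "(\<Sum>z\<in>X - T. num_ext \<I> j (insert z T)) = (\<Sum>S\<in>?F. \<Sum>z\<in>X - T. of_bool (z \<in> S))"
    by (simp only: sum.swap[of _ ?F])
  also have "\<dots> = (\<Sum>S\<in>?F. real j - real (card T))"
  proof (rule sum.cong)
    fix S assume S: "S \<in> ?F"
    then have f: "finite S" "T \<subseteq> S" "card S = j" "S \<subseteq> X"
      using finite_indep_set indep_subset_ground by auto
    then have "(X - T) \<inter> {z. z \<in> S} = S - T" by auto
    then have "(\<Sum>z\<in>X - T. of_bool (z \<in> S)) = real (card (S - T))"
      using finite_ground by (simp add: sum.If_cases of_bool_def)
    also have "\<dots> = real j - real (card T)"
      using f card_mono[of S T] by (auto simp: card_Diff_subset finite_subset[of T S] of_nat_diff)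
    finally show "(\<Sum>z\<in>X - T. of_bool (z \<in> S)) = real j - real (card T)" .
  qed simp
  also have "\<dots> = (real j - real (card T)) * num_ext \<I> j T" by (simp add: num_ext_def)
  finally show ?thesis .
qed

lemma indep_extend:
  assumes "S \<in> \<I>" "card S \<le> j" "j \<le> matroid_rank \<I>"
  shows "\<exists>B\<in>\<I>. S \<subseteq> B \<and> card B = j"
  using assms(2,3)
proof (induction j rule: dec_induct)
  case base
  then show ?case using assms(1) by blast
next
  case (step j)
  then obtain B where B: "B \<in> \<I>" "S \<subseteq> B" "card B = j" by auto
  have "matroid_rank \<I> \<in> card ` \<I>"
    unfolding matroid_rank_def using finite_indep indep_empty by (intro Max_in) auto
  then obtain R where "R \<in> \<I>" "card R = matroid_rank \<I>" by auto
  then obtain x where "x \<in> R - B" "insert x B \<in> \<I>"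
    using augment[of R B] B step.prems by auto
  then show ?case
    using B finite_indep_set[of B] by (intro bexI[of _ "insert x B"]) auto
qed

lemma num_ext_pos:
  assumes "S \<in> \<I>" "card S \<le> j" "j \<le> matroid_rank \<I>"
  shows "0 < num_ext \<I> j S"
  using indep_extend[OF assms] finite_indep by (auto simp: num_ext_def card_gt_0_iff)

lemma row_sum_ext_matrix:
  assumes "finite S"
  shows "(\<Sum>y\<in>X. ext_matrix \<I> k S x y) =
    (if x \<in> S then 0 else (real k - real (card S)) * num_ext \<I> (k + 1) (insert x S))"
proof (cases "x \<in> S")
  case False
  have "(\<Sum>y\<in>X. ext_matrix \<I> k S x y) =
      (\<Sum>y\<in>X - insert x S. num_ext \<I> (k + 1) (insert y (insert x S)))"
    using False finite_ground
    by (intro sum.mono_neutral_cong_right) (auto simp: ext_matrix_def insert_commute)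
  then show ?thesis using False assms by (simp add: sum_num_ext_insert)
qed (simp add: ext_matrix_def)

lemma sum_ext_vector:
  "(\<Sum>x\<in>X. ext_vector \<I> k S x) = (real k - real (card S)) * num_ext \<I> k S"
proof -
  have "(\<Sum>x\<in>X. ext_vector \<I> k S x) = (\<Sum>x\<in>X - S. num_ext \<I> k (insert x S))"
    using finite_ground by (intro sum.mono_neutral_cong_right) (auto simp: ext_vector_def)
  then show ?thesis by (simp add: sum_num_ext_insert)
qed

text \<open>Entries of the block have degree \<open>k - card S - 1\<close>. Border and corner have
  the same degree, so one factor serves the whole bordered form.\<close>

lemma sum_ext_matrix_insert:
  assumes "finite S"
  shows "(real k - real (card S) - 1) * ext_matrix \<I> k S x y =
    (\<Sum>z\<in>X - S. ext_matrix \<I> k (insert z S) x y)"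
proof (cases "x \<noteq> y \<and> x \<notin> S \<and> y \<notin> S")
  case True
  have "(\<Sum>z\<in>X - S. ext_matrix \<I> k (insert z S) x y) =
      (\<Sum>z\<in>X - insert x (insert y S). num_ext \<I> (k + 1) (insert z (insert x (insert y S))))"
    using True finite_ground
    by (intro sum.mono_neutral_cong_right) (auto simp: ext_matrix_def insert_commute)
  then show ?thesis using True assms by (simp add: sum_num_ext_insert ext_matrix_def)
next
  case False
  then show ?thesis by (auto simp: ext_matrix_def)
qed

lemma sum_ext_vector_insert:
  assumes "finite S"
  shows "(real k - real (card S) - 1) * ext_vector \<I> k S x =
    (\<Sum>z\<in>X - S. ext_vector \<I> k (insert z S) x)"
proof (cases "x \<in> S")
  case False
  have "(\<Sum>z\<in>X - S. ext_vector \<I> k (insert z S) x) =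
      (\<Sum>z\<in>X - insert x S. num_ext \<I> k (insert z (insert x S)))"
    using False finite_ground
    by (intro sum.mono_neutral_cong_right) (auto simp: ext_vector_def insert_commute)
  then show ?thesis using False assms by (simp add: sum_num_ext_insert ext_vector_def)
qed (simp add: ext_vector_def)

section \<open>Connectedness and the induction step\<close>

text \<open>Rows with nonzero sum belong to continuations of \<open>S\<close>. Two non-parallel ones
  are adjacent because they extend with \<open>S\<close> to an independent set of size
  \<open>k + 1\<close>; two parallel ones have a common neighbour.\<close>

lemma ext_matrix_connected:
  assumes S: "S \<in> \<I>" "card S < k" "k < matroid_rank \<I>"
    and f: "\<And>a b. a \<in> X \<Longrightarrow> b \<in> X \<Longrightarrow> ext_matrix \<I> k S a b \<noteq> 0 \<Longrightarrow> f a = f b"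
    and xy: "x \<in> X" "y \<in> X"
    and nz: "(\<Sum>z\<in>X. ext_matrix \<I> k S x z) \<noteq> 0" "(\<Sum>z\<in>X. ext_matrix \<I> k S y z) \<noteq> 0"
  shows "f x = f y"
proof -
  have fS: "finite S" using S finite_indep_set by blast
  have Cont: "a \<in> Cont X \<I> S" if "a \<in> X" "(\<Sum>z\<in>X. ext_matrix \<I> k S a z) \<noteq> 0" for a
    using that num_ext_dependent[of "insert a S" "k + 1"]
    by (auto simp: row_sum_ext_matrix[OF fS] Cont_def split: if_splits)
  have nonpar: "f a = f b"
    if "a \<in> Cont X \<I> S" "b \<in> Cont X \<I> S" "(a, b) \<notin> parallel_rel X \<I> S" for a b
  proof -
    have ab: "a \<in> X" "b \<in> X" "a \<notin> S" "b \<notin> S" "a \<noteq> b" "insert a (insert b S) \<in> \<I>"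
      using that by (auto simp: Cont_def parallel_rel_def)
    have "0 < num_ext \<I> (k + 1) (insert a (insert b S))"
      using ab S fS by (intro num_ext_pos) auto
    then show ?thesis using ab f[of a b] by (simp add: ext_matrix_def)
  qed
  note C = Cont[OF xy(1) nz(1)] Cont[OF xy(2) nz(2)]
  show ?thesis
  proof (cases "(x, y) \<in> parallel_rel X \<I> S")
    case True
    have x: "insert x S \<in> \<I>" "x \<notin> S" using C by (auto simp: Cont_def)
    \<comment> \<open>The second new element of \<open>B\<close> is not parallel to
      \<open>x\<close>, hence by transitivity not to \<open>y\<close>; the size
      \<open>card S + 2\<close> is at most the rank.\<close>
    obtain B where B: "B \<in> \<I>" "insert x S \<subseteq> B" "card B = card S + 2"
      using indep_extend[OF x(1), of "card S + 2"] S fS x by auto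
    then have "\<not> B \<subseteq> insert x S"
      using card_mono[of "insert x S" B] fS x by auto
    then obtain z where z: "z \<in> B" "z \<notin> insert x S" by blast
    have I: "S \<union> {x, z} \<in> \<I>" "insert z S \<in> \<I>"
      using B z by (auto intro!: indep_subset[OF B(1)])
    then have zC: "z \<in> Cont X \<I> S" using z indep_subset_ground by (auto simp: Cont_def)
    have xz: "(x, z) \<notin> parallel_rel X \<I> S" using I z by (auto simp: parallel_rel_def)
    then have "(y, z) \<notin> parallel_rel X \<I> S"
      using True equiv_parallel_rel[OF S(1)] by (meson equivE transE)
    then show ?thesis using nonpar[OF C(1) zC xz] nonpar[OF C(2) zC] by simp
  qed (use nonpar C in blast)
qed

text \<open>Applied to the all-ones vector, the Hessian at \<open>insert z S\<close> returns a
  multiple of row \<open>z\<close> of the Hessian at \<open>S\<close>. The induction hypothesis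
  therefore bounds each summand of Euler's identity by a squared row over its row sum, as
  \<open>hyperbolic_step\<close> demands.\<close>

lemma hyperbolic_ext_step:
  assumes S: "S \<in> \<I>" "card S + 1 < k" "k < matroid_rank \<I>"
    and IH: "\<And>z. z \<in> X - S \<Longrightarrow> insert z S \<in> \<I> \<Longrightarrow> hyperbolic X (ext_matrix \<I> k (insert z S))
      (ext_vector \<I> k (insert z S)) (c * num_ext \<I> (k - 1) (insert z S))"
  shows "hyperbolic X (ext_matrix \<I> k S) (ext_vector \<I> k S) (c * num_ext \<I> (k - 1) S)"
proof (rule hyperbolic_step[OF finite_ground ext_matrix_commute ext_matrix_nonneg])
  show "f x = f y"
    if "\<And>a b. a \<in> X \<Longrightarrow> b \<in> X \<Longrightarrow> ext_matrix \<I> k S a b \<noteq> 0 \<Longrightarrow> f a = f b" "x \<in> X" "y \<in> X"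
      "(\<Sum>z\<in>X. ext_matrix \<I> k S x z) \<noteq> 0" "(\<Sum>z\<in>X. ext_matrix \<I> k S y z) \<noteq> 0"
    for f :: "'a \<Rightarrow> real" and x y
    by (rule ext_matrix_connected[of S k f, OF S(1) _ S(3)]) (use S(2) in linarith, (fact that)+)
next
  fix u t
  have fS: "finite S" using S finite_indep_set by blast
  \<comment> \<open>\<open>m - 1\<close> is the common degree of the entries; it is positive because
    the base case is excluded.\<close>
  define m where "m = real k - real (card S)"
  have m: "m - 1 > 0" using S by (simp add: m_def)
  let ?B = "\<lambda>T. bordered X (ext_matrix \<I> k T) (ext_vector \<I> k T) (c * num_ext \<I> (k - 1) T) u t"
  let ?A = "\<lambda>z. (\<Sum>y\<in>X. ext_matrix \<I> k S z y * u y) + t * ext_vector \<I> k S z"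
  let ?D = "\<lambda>z. \<Sum>y\<in>X. ext_matrix \<I> k S z y"
  have "(m - 1) * (c * num_ext \<I> (k - 1) S) = (\<Sum>z\<in>X - S. c * num_ext \<I> (k - 1) (insert z S))"
    using S by (simp add: sum_num_ext_insert m_def of_nat_diff flip: sum_distrib_left)
  then have "(m - 1) * ?B S = (\<Sum>z\<in>X - S. ?B (insert z S))"
    using sum_ext_matrix_insert[OF fS, of k] sum_ext_vector_insert[OF fS, of k]
    by (intro bordered_sum) (auto simp: m_def)
  also have "\<dots> \<le> (\<Sum>z\<in>X - S. (m - 1) * ((?A z)\<^sup>2 / ?D z))"
  proof (rule sum_mono)
    fix z assume z: "z \<in> X - S"
    have cz: "real (card (insert z S)) = real (card S) + 1" using z fS by simp
    have Dz: "?D z = m * num_ext \<I> (k + 1) (insert z S)"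
      using z fS by (simp add: row_sum_ext_matrix m_def)
    show "?B (insert z S) \<le> (m - 1) * ((?A z)\<^sup>2 / ?D z)"
    proof (cases "insert z S \<in> \<I>")
      case True
      have row: "(\<Sum>y\<in>X. ext_matrix \<I> k (insert z S) x y) = (m - 1) * ext_matrix \<I> k S z x" for x
        using z cz fS row_sum_ext_matrix[of "insert z S" k x]
        by (auto simp: m_def ext_matrix_def insert_commute)
      have W: "(\<Sum>x\<in>X. \<Sum>y\<in>X. ext_matrix \<I> k (insert z S) x y) = (m - 1) * ?D z"
        by (simp add: row flip: sum_distrib_left)
      have "(\<Sum>x\<in>X. ext_vector \<I> k (insert z S) x) = (m - 1) * ext_vector \<I> k S z"
        using z unfolding sum_ext_vector cz by (simp add: m_def ext_vector_def)
      then have L: "(\<Sum>x\<in>X. (\<Sum>y\<in>X. ext_matrix \<I> k (insert z S) x y) * u x) +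
          t * (\<Sum>x\<in>X. ext_vector \<I> k (insert z S) x) = (m - 1) * ?A z"
        by (simp add: row distrib_left sum_distrib_left mult_ac)
      have "?B (insert z S) * ((m - 1) * ?D z) \<le> ((m - 1) * ?A z)\<^sup>2"
        using IH[OF z True, unfolded hyperbolic_def, rule_format, of u t] unfolding W L .
      then have "(m - 1) * (?B (insert z S) * ?D z) \<le> (m - 1) * ((m - 1) * (?A z)\<^sup>2)"
        by (simp add: power_mult_distrib power2_eq_square mult_ac)
      then have "?B (insert z S) * ?D z \<le> (m - 1) * (?A z)\<^sup>2" using m by simp
      moreover have "0 < ?D z"
        using True S z fS m unfolding Dz by (intro mult_pos_pos num_ext_pos) auto
      ultimately show ?thesis by (simp add: pos_le_divide_eq)
    next
      case False
      \<comment> \<open>The derivative along a dependent set vanishes; the row sum is then 0 as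
        well, and the quotient is 0 by convention.\<close>
      then have "insert a (insert b (insert z S)) \<notin> \<I>" "insert a (insert z S) \<notin> \<I>" for a b
        using indep_subset by blast+
      then have "ext_matrix \<I> k (insert z S) x y = 0" "ext_vector \<I> k (insert z S) x = 0" for x y
        by (simp_all add: ext_matrix_def ext_vector_def num_ext_dependent)
      then have "?B (insert z S) = 0"
        using False by (simp add: bordered_def bilin_def num_ext_dependent)
      moreover have "0 \<le> (m - 1) * ((?A z)\<^sup>2 / ?D z)"
        using m by (intro mult_nonneg_nonneg divide_nonneg_nonneg sum_nonneg ext_matrix_nonneg) auto
      ultimately show ?thesis by (simp only:)
    qed
  qed
  also have "\<dots> \<le> (\<Sum>z\<in>X. (m - 1) * ((?A z)\<^sup>2 / ?D z))"
    using finite_ground m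
    by (intro sum_mono2 mult_nonneg_nonneg divide_nonneg_nonneg sum_nonneg ext_matrix_nonneg) auto
  also have "\<dots> = (m - 1) * (\<Sum>z\<in>X. (?A z)\<^sup>2 / ?D z)" by (simp add: sum_distrib_left)
  finally show "?B S \<le> (\<Sum>z\<in>X. (?A z)\<^sup>2 / ?D z)" using m by simp
qed

end

section \<open>Base case: parallel classes\<close>

text \<open>The indicator matrix of an equivalence relation is block diagonal with all-ones blocks,
  so its quadratic form is a sum of squared class sums.\<close>

lemma sum_equiv_classes:
  fixes u :: "'a \<Rightarrow> real"
  assumes "equiv C r" "finite C"
  shows "(\<Sum>x\<in>C. u x * (\<Sum>y\<in>r `` {x}. u y)) = (\<Sum>c\<in>C // r. (\<Sum>x\<in>c. u x)\<^sup>2)"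
    and "(\<Sum>x\<in>C. u x) = (\<Sum>c\<in>C // r. \<Sum>x\<in>c. u x)"
proof -
  have part: "(\<Sum>x\<in>C. g x) = (\<Sum>c\<in>C // r. \<Sum>x\<in>c. g x)" for g :: "'a \<Rightarrow> real"
  proof -
    have "(\<Sum>x\<in>\<Union>(C // r). g x) = (\<Sum>c\<in>C // r. \<Sum>x\<in>c. g x)"
      using quotient_disj[OF assms(1)] finite_subset[OF in_quotient_imp_subset[OF assms(1)] assms(2)]
      by (subst sum.Union_disjoint) auto
    then show ?thesis using Union_quotient[OF assms(1)] by simp
  qed
  then show "(\<Sum>x\<in>C. u x) = (\<Sum>c\<in>C // r. \<Sum>x\<in>c. u x)" .
  have "(\<Sum>x\<in>c. u x * (\<Sum>y\<in>r `` {x}. u y)) = (\<Sum>x\<in>c. u x)\<^sup>2" if "c \<in> C // r" for c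
  proof -
    have "r `` {x} = c" if "x \<in> c" for x
      using \<open>c \<in> C // r\<close> that assms(1) by (metis Image_singleton_iff equiv_class_eq quotientE)
    then show ?thesis by (simp add: power2_eq_square sum_distrib_right)
  qed
  then show "(\<Sum>x\<in>C. u x * (\<Sum>y\<in>r `` {x}. u y)) = (\<Sum>c\<in>C // r. (\<Sum>x\<in>c. u x)\<^sup>2)"
    by (simp add: part)
qed

context matroid
begin

text \<open>The form is \<open>V\<^sup>2 - Z + 2 t V + c t\<^sup>2\<close>, with \<open>V\<close>
  the sum over the continuations, \<open>Z\<close> the sum of squared class sums and
  \<open>c = K / (K - 1)\<close>. Cauchy-Schwarz gives \<open>Z \<ge> V\<^sup>2 / K\<close>, leaving
  at most \<open>(1 - 1 / K) (V + c t)\<^sup>2\<close>; this fixes the constant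
  \<open>c\<close>.\<close>

lemma hyperbolic_ext_base:
  assumes S: "S \<in> \<I>" "card S + 1 = k" and K: "card (Par X \<I> S) \<le> K" "2 \<le> K"
  shows "hyperbolic X (ext_matrix \<I> k S) (ext_vector \<I> k S)
    ((1 + 1 / (real K - 1)) * num_ext \<I> (k - 1) S)"
proof (rule hyperbolic_if_shift[OF ext_matrix_commute])
  show "0 \<le> (\<Sum>x\<in>X. \<Sum>y\<in>X. ext_matrix \<I> k S x y)"
    by (intro sum_nonneg ext_matrix_nonneg)
next
  fix u t assume nz: "(\<Sum>x\<in>X. \<Sum>y\<in>X. ext_matrix \<I> k S x y) \<noteq> 0"
  let ?C = "Cont X \<I> S" and ?r = "parallel_rel X \<I> S" and ?M = "ext_matrix \<I> k S"
  have fS: "finite S" using S finite_indep_set by blast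
  have fC: "finite ?C" "?C \<subseteq> X" using finite_ground by (auto simp: Cont_def)
  have M: "?M x y = of_bool (x \<in> ?C \<and> y \<in> ?C) - of_bool ((x, y) \<in> ?r)" if "x \<in> X" "y \<in> X" for x y
  proof (cases "x \<noteq> y \<and> x \<notin> S \<and> y \<notin> S")
    case True
    then have "?M x y = of_bool (insert x (insert y S) \<in> \<I>)"
      using num_ext_card[of "insert x (insert y S)"] fS S(2) by (simp add: ext_matrix_def flip: S(2))
    moreover have "insert x S \<in> \<I>" "insert y S \<in> \<I>" if "insert x (insert y S) \<in> \<I>"
      using that by (auto intro: indep_subset)
    ultimately show ?thesis using True that by (auto simp: Cont_def parallel_rel_def)
  qed (use that in \<open>auto simp: ext_matrix_def Cont_def parallel_rel_def\<close>)
  have q: "ext_vector \<I> k S x = of_bool (x \<in> ?C)" if "x \<in> X" for x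
    using num_ext_card[of "insert x S"] fS that
    by (auto simp: ext_vector_def Cont_def simp flip: S(2))
  have r: "num_ext \<I> (k - 1) S = 1" using num_ext_card[OF fS] S by (simp flip: S(2))
  have "?C \<noteq> {}"
  proof
    assume "?C = {}"
    then have "(\<Sum>x\<in>X. \<Sum>y\<in>X. ?M x y) = 0"
      using M by (intro sum.neutral ballI) (auto simp: parallel_rel_def)
    then show False using nz by simp
  qed
  then have card: "real (card ?C) \<noteq> 0" using fC by simp
  \<comment> \<open>Chosen so that the shifted sum \<open>?V\<close> is the double root
    \<open>- c t\<close> of that square.\<close>
  define s where "s = (- (real K * t / (real K - 1)) - (\<Sum>x\<in>?C. u x)) / card ?C"
  define w where "w x = u x + s" for x
  let ?V = "\<Sum>x\<in>?C. w x" and ?Z = "\<Sum>c\<in>Par X \<I> S. (\<Sum>x\<in>c. w x)\<^sup>2"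
  have V: "?V = - (real K * t / (real K - 1))"
    using card by (simp add: w_def sum.distrib s_def)
  have restr: "(\<Sum>x\<in>X. of_bool (x \<in> B) * g x) = (\<Sum>x\<in>B. g x)" if "B \<subseteq> X" for B and g :: "'a \<Rightarrow> real"
    using that finite_ground by (intro sum.mono_neutral_cong_right) auto
  have "bilin X ?M w w = ?V\<^sup>2 - ?Z"
  proof -
    have "(\<Sum>y\<in>X. ?M x y * w y) = of_bool (x \<in> ?C) * (?V - (\<Sum>y\<in>?r `` {x}. w y))" if "x \<in> X" for x
    proof -
      have "(\<Sum>y\<in>X. ?M x y * w y) = (\<Sum>y\<in>X. of_bool (x \<in> ?C) * (of_bool (y \<in> ?C) * w y)
          - of_bool (y \<in> ?r `` {x}) * w y)"
        using M that by (intro sum.cong) (auto simp: left_diff_distrib)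
      also have "\<dots> = of_bool (x \<in> ?C) * ?V - (\<Sum>y\<in>?r `` {x}. w y)"
        unfolding sum_subtractf sum_distrib_left[symmetric] restr[OF fC(2)]
        by (subst restr) (use fC in \<open>auto simp: parallel_rel_def\<close>)
      finally show ?thesis by (cases "x \<in> ?C") (auto simp: parallel_rel_def)
    qed
    then have "bilin X ?M w w = (\<Sum>x\<in>X. of_bool (x \<in> ?C) * (w x * (?V - (\<Sum>y\<in>?r `` {x}. w y))))"
      unfolding bilin_def by (intro sum.cong) auto
    also have "\<dots> = (\<Sum>x\<in>?C. w x * (?V - (\<Sum>y\<in>?r `` {x}. w y)))" by (rule restr[OF fC(2)])
    also have "\<dots> = ?V\<^sup>2 - (\<Sum>x\<in>?C. w x * (\<Sum>y\<in>?r `` {x}. w y))"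
      by (simp add: right_diff_distrib sum_subtractf power2_eq_square sum_distrib_right)
    finally show ?thesis
      using sum_equiv_classes(1)[OF equiv_parallel_rel[OF S(1)] fC(1), of w] by (simp add: Par_def)
  qed
  moreover have "(\<Sum>x\<in>X. ext_vector \<I> k S x * w x) = ?V"
    unfolding restr[OF fC(2), symmetric] using q by (intro sum.cong) auto
  ultimately have Q: "bordered X ?M (ext_vector \<I> k S) ((1 + 1 / (real K - 1)) * num_ext \<I> (k - 1) S) w t
      = ?V\<^sup>2 - ?Z + 2 * t * ?V + (1 + 1 / (real K - 1)) * t\<^sup>2"
    unfolding bordered_def r by simp
  have "?V\<^sup>2 = (\<Sum>c\<in>Par X \<I> S. \<Sum>x\<in>c. w x)\<^sup>2"
    using sum_equiv_classes(2)[OF equiv_parallel_rel[OF S(1)] fC(1), of w] by (simp add: Par_def)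
  also have "\<dots> \<le> ?Z * card (Par X \<I> S)" by (rule sum_squared_le_sum_of_squares)
  also have "\<dots> \<le> ?Z * K" using K by (intro mult_left_mono sum_nonneg) auto
  finally have Z: "?V\<^sup>2 / K \<le> ?Z" using K by (simp add: pos_divide_le_eq)
  have "?V\<^sup>2 - ?V\<^sup>2 / K + 2 * t * ?V + (1 + 1 / (real K - 1)) * t\<^sup>2 = 0"
  proof -
    \<comment> \<open>Writing \<open>t = a * b\<close> with \<open>a = K - 1\<close> clears the
      denominators.\<close>
    define a where "a = real K - 1"
    have a: "a > 0" "real K = a + 1" using K by (auto simp: a_def)
    define b where "b = t / a"
    have t: "t = a * b" using a by (simp add: b_def)
    have V': "?V = - ((a + 1) * b)" using V a by (simp add: b_def)
    have "?V\<^sup>2 / K = (a + 1) * b\<^sup>2"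
      unfolding V' a(2) using a(1) by (simp add: power_mult_distrib power2_eq_square[of "a + 1"])
    moreover have "(1 + 1 / a) * t\<^sup>2 = (a + 1) * a * b\<^sup>2"
      unfolding t using a(1) by (simp add: field_simps power2_eq_square)
    ultimately have "?V\<^sup>2 - ?V\<^sup>2 / K + 2 * t * ?V + (1 + 1 / (real K - 1)) * t\<^sup>2 =
        (- ((a + 1) * b))\<^sup>2 - (a + 1) * b\<^sup>2 + 2 * (a * b) * - ((a + 1) * b) + (a + 1) * a * b\<^sup>2"
      by (simp only: V' a_def[symmetric] flip: t)
    then show ?thesis by (simp add: algebra_simps power2_eq_square)
  qed
  then have "bordered X ?M (ext_vector \<I> k S) ((1 + 1 / (real K - 1)) * num_ext \<I> (k - 1) S) w t \<le> 0"
    unfolding Q using Z by linarith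
  then show "\<exists>s. bordered X ?M (ext_vector \<I> k S)
      ((1 + 1 / (real K - 1)) * num_ext \<I> (k - 1) S) (\<lambda>x. u x + s) t \<le> 0"
    unfolding w_def by blast
qed

section \<open>Downward induction and conclusion\<close>

text \<open>The continuation number bounds the number of parallel classes for every \<open>S\<close>
  of size \<open>k - 1\<close>, so all base cases share one constant.\<close>

lemma hyperbolic_ext:
  assumes "S \<in> \<I>" "card S < k" "k < matroid_rank \<I>"
  shows "hyperbolic X (ext_matrix \<I> k S) (ext_vector \<I> k S)
    ((1 + 1 / (real (continuation_number X \<I> (k - 1)) - 1)) * num_ext \<I> (k - 1) S)"
  using assms(1,2)
proof (induction "k - card S" arbitrary: S rule: less_induct)
  case less
  show ?case
  proof (cases "card S + 1 = k")
    case True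
    have "card (Par X \<I> S) \<le> continuation_number X \<I> (k - 1)"
      unfolding continuation_number_def using less.prems True finite_indep
      by (intro Max_ge) (auto simp: indep_sets_def)
    moreover have "2 \<le> continuation_number X \<I> (k - 1)"
      using True assms(3) by (intro continuation_number_ge_2) auto
    ultimately show ?thesis using less.prems True by (intro hyperbolic_ext_base)
  next
    case False
    show ?thesis
    proof (rule hyperbolic_ext_step)
      fix z assume "z \<in> X - S" "insert z S \<in> \<I>"
      then show "hyperbolic X (ext_matrix \<I> k (insert z S)) (ext_vector \<I> k (insert z S))
          ((1 + 1 / (real (continuation_number X \<I> (k - 1)) - 1)) * num_ext \<I> (k - 1) (insert z S))"
        using less.prems False finite_indep_set[of S] by (intro less.hyps) auto
    qed (use less.prems False assms(3) in auto)
  qed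
qed

end

theorem theorem1p4:
  fixes X :: "'a set" and \<I> :: "'a set set" and k :: nat
  assumes "matroid X \<I>"
    and "1 \<le> k" and "k < matroid_rank \<I>"
  shows "(real (num_indep \<I> k))\<^sup>2 \<ge>
    (1 + 1 / real k) * (1 + 1 / (real (continuation_number X \<I> (k - 1)) - 1)) *
      real (num_indep \<I> (k - 1)) * real (num_indep \<I> (k + 1))"
proof -
  interpret matroid X \<I> by fact
  let ?c = "1 + 1 / (real (continuation_number X \<I> (k - 1)) - 1)"
  let ?I = "\<lambda>j. real (num_indep \<I> j)"
  have "(\<Sum>x\<in>X. \<Sum>y\<in>X. ext_matrix \<I> k {} x y) = (\<Sum>x\<in>X - {}. real k * num_ext \<I> (k + 1) (insert x {}))"
    by (simp add: row_sum_ext_matrix)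
  also have "\<dots> = real k * ((real k + 1) * ?I (k + 1))"
    unfolding sum_distrib_left[symmetric] sum_num_ext_insert by (simp add: num_ext_empty)
  finally have W: "(\<Sum>x\<in>X. \<Sum>y\<in>X. ext_matrix \<I> k {} x y) = real k * ((real k + 1) * ?I (k + 1))" .
  have L: "(\<Sum>x\<in>X. ext_vector \<I> k {} x) = real k * ?I k"
    by (simp add: sum_ext_vector num_ext_empty)
  have "hyperbolic X (ext_matrix \<I> k {}) (ext_vector \<I> k {}) (?c * ?I (k - 1))"
    using hyperbolic_ext[OF indep_empty, of k] assms by (simp add: num_ext_empty)
  \<comment> \<open>In the direction \<open>u = 0\<close>, \<open>t = 1\<close> the form is just the
    corner entry.\<close>
  from this[unfolded hyperbolic_def W L, rule_format, of "\<lambda>_. 0" 1]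
  have *: "?c * ?I (k - 1) * (real k * ((real k + 1) * ?I (k + 1))) \<le> (real k)\<^sup>2 * (?I k)\<^sup>2"
    by (simp add: bordered_def bilin_def power_mult_distrib)
  \<comment> \<open>The factor \<open>1 + 1 / k\<close> comes from
    \<open>k (k + 1) / k\<^sup>2\<close>.\<close>
  have "(real k)\<^sup>2 * ((1 + 1 / real k) * ?c * ?I (k - 1) * ?I (k + 1)) =
      (real k * (1 + 1 / real k)) * (real k * (?c * ?I (k - 1) * ?I (k + 1)))"
    by (simp add: power2_eq_square mult_ac)
  also have "real k * (1 + 1 / real k) = real k + 1" using assms(2) by (simp add: distrib_left)
  also have "(real k + 1) * (real k * (?c * ?I (k - 1) * ?I (k + 1))) \<le> (real k)\<^sup>2 * (?I k)\<^sup>2"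
    using * by (simp add: mult_ac)
  finally show ?thesis using assms(2) by (simp add: mult_le_cancel_left_pos)
qed

end
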